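(* Fix a state $x=(x_1,\dots,x_M)$ and initial opinions $\mathcal C_{[i]}(0)=\mathcal C_{[i]}^0\in\Pi_{\mathcal M}$, $i\in\mathcal M=\{1,\dots,M\}$. Let $\mathfrak C=\{(\mathcal C_{[i]}(p),\mathcal C_{[-i]}(p))\}_{p,i}$, $p=0,1,\dots$, $i=(p+1)\bmod M$, be the path of opinion profiles generated by the serial recursion $$\mathcal C_{[i]}(p+1)=\arg\min\bigl\{J_i(\mathcal C_{[i]};\mathcal C_{[-i]}(p),x):\mathcal C_{[i]}\in\mathbb C_\Delta(\mathcal C_{[i]}(p))\bigr\},$$ in which the subsystems update one at a time in the order $1,2,\dots,M$. If $\Delta\ge1$, then $\mathfrak C$ is a finite improvement path, terminating in a Nash equilibrium $(\mathcal C_{[1]}^e,\dots,\mathcal C_{[M]}^e)$ that is a minimum of the potential function $$\phi(\mathcal C_{[1]},\dots,\mathcal C_{[M]})=\sum_{i\in\mathcal M}\Bigl(\tfrac12J_i^{\mathrm{consensus}}+\rho J_i^{\mathrm{power}}\Bigr).$$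
   Context: A linear system $x^+=Ax+Bu$ is partitioned into $M$ subsystems with states $x_i\in\mathbb R^{n_i}$; $A=[A_{ij}]$ in block form. The neighbours of $i\in\mathcal M$ are $\mathcal M_i=\{j\in\mathcal M\setminus\{i\}:A_{ij}\neq0\}$. $\Pi_{\mathcal M}$ is the set of all set partitions of $\mathcal M$ (blocks are called coalitions). For $\mathcal C\in\Pi_{\mathcal M}$, $\delta_{ij}(\mathcal C)=\delta_{ji}(\mathcal C)=0$ if $i,j$ belong to the same block of $\mathcal C$, and $1$ otherwise. Weights: $w_{ij}(x_i,x_j)=w_{ji}(x_j,x_i)=\frac12(\|A_{ij}\||x_j|+\|A_{ji}\||x_i|)$; $\sigma_{ij}=\sigma_{ji}>0$; $\rho,\epsilon>0$. With $\mathcal C_{[-i]}=\{\mathcal C_{[j]}\}_{j\in\mathcal M_i}$ the neighbours' opinions, $J_i(\mathcal C_{[i]};\mathcal C_{[-i]},x)=J_i^{\mathrm{consensus}}+\rho J_i^{\mathrm{power}}$, where $$J_i^{\mathrm{consensus}}=\sum_{j\in\mathcal M_i}w_{ij}(x_i,x_j)\,|\delta_{ij}(\mathcal C_{[i]})-\delta_{ij}(\mathcal C_{[j]})|,\qquad J_i^{\mathrm{power}}=\sum_{j\in\mathcal M_i}(w_{ij}(x_i,x_j)+\epsilon)\,\sigma_{ij}\,(1-\delta_{ij}(\mathcal C_{[i]})).$$ Refinement order on $\Pi_{\mathcal M}$: $\mathcal D\preceq\mathcal C$ ($\mathcal D$ refines $\mathcal C$, $\mathcal C$ coarsens $\mathcal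 D$) if every block of $\mathcal D$ is contained in a block of $\mathcal C$. For $\mathcal C\in\Pi_{\mathcal M}$ and $\Delta\ge1$, $\mathbb C_\Delta(\mathcal C)\subset\Pi_{\mathcal M}$ is the set of partitions (including $\mathcal C$) reachable from $\mathcal C$ by at most $\Delta$ moves along chains of $\Pi_{\mathcal M}$ (ordered by $\preceq$) that contain $\mathcal C$, a move being a step between adjacent elements of the Hasse diagram; thus all elements of $\mathbb C_\Delta(\mathcal C)$ are refinements or coarsenings of $\mathcal C$. A path is an improvement path if $\phi(\mathcal C_{[i]}(p+1),\mathcal C_{[-i]}(p))<\phi(\mathcal C_{[i]}(p),\mathcal C_{[-i]}(p))$ for all $p\ge1$ along it. A Nash equilibrium is a profile of opinions in which each $\mathcal C_{[i]}^e$ minimizes $J_i(\cdot;\mathcal C_{[-i]}^e,x)$ over $\Pi_{\mathcal M}$.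
   Formalization: Neighbours are assumed symmetric (A_ij≠0 implies A_ji≠0); in the arg min a subsystem keeps its opinion if already minimal; steps without a move are dropped from the path; "minimum of the potential" means no unilateral change of opinion lowers φ (it need not be global). *)

theory Defs
  imports "HOL-Analysis.Analysis" "HOL-Library.Disjoint_Sets"
begin

text \<open>
  The state space is \<open>real^'n\<close>, and \<open>s :: 'n \<Rightarrow> nat\<close> assigns each coordinate to the subsystem it
  belongs to, so that subsystem \<open>i\<close> has dimension \<open>card {r. s r = i}\<close>.  The block \<open>A_ij\<close> and the
  subsystem state \<open>x_i\<close> are padded with zeros to the ambient size.  The padding changes neither the
  Euclidean norm of \<open>x_i\<close>, nor the induced operator norm of \<open>A_ij\<close>, nor whether \<open>A_ij = 0\<close>.
\<close>

definition block :: "('n \<Rightarrow> nat) \<Rightarrow> real^'n^'n \<Rightarrow> nat \<Rightarrow> nat \<Rightarrow> real^'n^'n" where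
  "block s A i j = (\<chi> r c. if s r = i \<and> s c = j then A $ r $ c else 0)"

definition substate :: "('n \<Rightarrow> nat) \<Rightarrow> real^'n \<Rightarrow> nat \<Rightarrow> real^'n" where
  "substate s x i = (\<chi> r. if s r = i then x $ r else 0)"

definition neighbours :: "nat \<Rightarrow> ('n \<Rightarrow> nat) \<Rightarrow> real^'n^'n \<Rightarrow> nat \<Rightarrow> nat set" where
  "neighbours M s A i = {j \<in> {1..M} - {i}. block s A i j \<noteq> 0}"

definition weight :: "('n \<Rightarrow> nat) \<Rightarrow> real^'n^'n \<Rightarrow> real^'n \<Rightarrow> nat \<Rightarrow> nat \<Rightarrow> real" where
  "weight s A x i j =
     1 / 2 * (onorm ((*v) (block s A i j)) * norm (substate s x j)
            + onorm ((*v) (block s A j i)) * norm (substate s x i))"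

type_synonym opinion = "nat set set"
type_synonym profile = "nat \<Rightarrow> opinion"

definition opinions :: "nat \<Rightarrow> opinion set" where
  "opinions M = {c. partition_on {1..M} c}"

definition delta :: "opinion \<Rightarrow> nat \<Rightarrow> nat \<Rightarrow> real" where
  "delta c i j = (if \<exists>B\<in>c. i \<in> B \<and> j \<in> B then 0 else 1)"

text \<open>
  In the costs below, \<open>N i\<close> is the neighbour set of \<open>i\<close>, \<open>w\<close> the weights at the fixed state,
  \<open>c\<close> the opinion of \<open>i\<close> and \<open>C\<close> the profile of opinions, of which only the entries of the
  neighbours of \<open>i\<close> are used.
\<close>

definition consensus_cost ::
    "(nat \<Rightarrow> nat set) \<Rightarrow> (nat \<Rightarrow> nat \<Rightarrow> real) \<Rightarrow> nat \<Rightarrow> opinion \<Rightarrow> profile \<Rightarrow> real" where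
  "consensus_cost N w i c C = (\<Sum>j\<in>N i. w i j * \<bar>delta c i j - delta (C j) i j\<bar>)"

definition power_cost ::
    "(nat \<Rightarrow> nat set) \<Rightarrow> (nat \<Rightarrow> nat \<Rightarrow> real) \<Rightarrow> (nat \<Rightarrow> nat \<Rightarrow> real) \<Rightarrow> real \<Rightarrow> nat \<Rightarrow> opinion \<Rightarrow> real"
  where
  "power_cost N w \<sigma> \<epsilon> i c = (\<Sum>j\<in>N i. (w i j + \<epsilon>) * \<sigma> i j * (1 - delta c i j))"

definition cost ::
    "(nat \<Rightarrow> nat set) \<Rightarrow> (nat \<Rightarrow> nat \<Rightarrow> real) \<Rightarrow> (nat \<Rightarrow> nat \<Rightarrow> real) \<Rightarrow> real \<Rightarrow> real
      \<Rightarrow> nat \<Rightarrow> opinion \<Rightarrow> profile \<Rightarrow> real" where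
  "cost N w \<sigma> \<rho> \<epsilon> i c C = consensus_cost N w i c C + \<rho> * power_cost N w \<sigma> \<epsilon> i c"

definition potential ::
    "nat \<Rightarrow> (nat \<Rightarrow> nat set) \<Rightarrow> (nat \<Rightarrow> nat \<Rightarrow> real) \<Rightarrow> (nat \<Rightarrow> nat \<Rightarrow> real) \<Rightarrow> real \<Rightarrow> real
      \<Rightarrow> profile \<Rightarrow> real" where
  "potential M N w \<sigma> \<rho> \<epsilon> C =
     (\<Sum>i\<in>{1..M}. 1 / 2 * consensus_cost N w i (C i) C + \<rho> * power_cost N w \<sigma> \<epsilon> i (C i))"

definition hasse_below :: "nat \<Rightarrow> opinion \<Rightarrow> opinion \<Rightarrow> bool" where
  "hasse_below M d c \<longleftrightarrow> refines {1..M} d c \<and> d \<noteq> c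
     \<and> (\<forall>e. refines {1..M} d e \<and> refines {1..M} e c \<longrightarrow> e = d \<or> e = c)"

definition hasse_adjacent :: "nat \<Rightarrow> opinion \<Rightarrow> opinion \<Rightarrow> bool" where
  "hasse_adjacent M c d \<longleftrightarrow> hasse_below M c d \<or> hasse_below M d c"

definition reachable :: "nat \<Rightarrow> nat \<Rightarrow> opinion \<Rightarrow> opinion set" where
  "reachable M \<Delta> c =
     {d. \<exists>K ds. K \<subseteq> opinions M \<and> Complete_Partial_Order.chain (refines {1..M}) K \<and> c \<in> K
        \<and> ds \<noteq> [] \<and> hd ds = c \<and> last ds = d \<and> set ds \<subseteq> K
        \<and> successively (hasse_adjacent M) ds \<and> length ds \<le> \<Delta> + 1}"

text \<open>
  Minimizers of the cost are in general not unique, since the cost of \<open>i\<close> depends only on the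
  coalition containing \<open>i\<close>.  A subsystem keeps its current opinion whenever that is already a
  minimizer; otherwise it may move to any minimizer.  At step \<open>p\<close> the active subsystem is the
  representative in \<open>{1..M}\<close> of \<open>p + 1\<close> modulo \<open>M\<close>.
\<close>

definition best_update ::
    "nat \<Rightarrow> nat \<Rightarrow> (nat \<Rightarrow> opinion \<Rightarrow> profile \<Rightarrow> real) \<Rightarrow> nat \<Rightarrow> profile \<Rightarrow> opinion \<Rightarrow> bool" where
  "best_update M \<Delta> J i C d \<longleftrightarrow>
     is_arg_min (\<lambda>e. J i e C) (\<lambda>e. e \<in> reachable M \<Delta> (C i)) d
     \<and> (is_arg_min (\<lambda>e. J i e C) (\<lambda>e. e \<in> reachable M \<Delta> (C i)) (C i) \<longrightarrow> d = C i)"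

definition serial_recursion ::
    "nat \<Rightarrow> nat \<Rightarrow> (nat \<Rightarrow> opinion \<Rightarrow> profile \<Rightarrow> real) \<Rightarrow> (nat \<Rightarrow> profile) \<Rightarrow> bool" where
  "serial_recursion M \<Delta> J C \<longleftrightarrow>
     (\<forall>p. let i = p mod M + 1 in \<exists>d. best_update M \<Delta> J i (C p) d \<and> C (Suc p) = (C p)(i := d))"

text \<open>
  The recursion also produces steps at which the active subsystem keeps its opinion.  As a path,
  such a run is read with these repetitions removed: every actual move must strictly decrease the
  potential, and the path is finite if the run is eventually constant.
\<close>

definition improvement_path :: "(profile \<Rightarrow> real) \<Rightarrow> (nat \<Rightarrow> profile) \<Rightarrow> bool" where
  "improvement_path \<phi> C \<longleftrightarrow> (\<forall>p. C (Suc p) \<noteq> C p \<longrightarrow> \<phi> (C (Suc p)) < \<phi> (C p))"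

definition terminates_in :: "(nat \<Rightarrow> profile) \<Rightarrow> profile \<Rightarrow> bool" where
  "terminates_in C E \<longleftrightarrow> (\<exists>P. \<forall>p\<ge>P. C p = E)"

definition nash_equilibrium ::
    "nat \<Rightarrow> (nat \<Rightarrow> opinion \<Rightarrow> profile \<Rightarrow> real) \<Rightarrow> profile \<Rightarrow> bool" where
  "nash_equilibrium M J E \<longleftrightarrow>
     (\<forall>i\<in>{1..M}. is_arg_min (\<lambda>d. J i d E) (\<lambda>d. d \<in> opinions M) (E i))"

text \<open>
  A minimum of the potential in the sense of potential games: no player can lower the potential by
  a unilateral change of opinion.  It need not be a global minimum: the global minimum is \<open>0\<close>,
  attained when all opinions are the partition into singletons, whereas coalitions on which the
  members agree persist when \<open>\<rho>\<close> is small.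
\<close>

definition potential_minimum :: "nat \<Rightarrow> (profile \<Rightarrow> real) \<Rightarrow> profile \<Rightarrow> bool" where
  "potential_minimum M \<phi> E \<longleftrightarrow>
     (\<forall>i\<in>{1..M}. is_arg_min (\<lambda>d. \<phi> (E(i := d))) (\<lambda>d. d \<in> opinions M) (E i))"

text \<open>The serial recursion can be run from every initial profile.\<close>

lemma reachable_subset: "reachable M \<Delta> c \<subseteq> opinions M"
  unfolding reachable_def by (auto dest!: last_in_set)

lemma self_reachable: "c \<in> opinions M \<Longrightarrow> c \<in> reachable M \<Delta> c"
  unfolding reachable_def opinions_def Complete_Partial_Order.chain_def
  by (auto intro!: exI[of _ "{c}"] exI[of _ "[c]"] refines_refl)

lemma best_update_exists:
  assumes "C i \<in> opinions M"
  shows "\<exists>d. best_update M \<Delta> J i C d"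
proof -
  have "finite (reachable M \<Delta> (C i))"
    using finite_subset[OF reachable_subset] finitely_many_partition_on[of "{1..M}"]
    by (auto simp: opinions_def)
  then obtain d where "is_arg_min (\<lambda>e. J i e C) (\<lambda>e. e \<in> reachable M \<Delta> (C i)) d"
    using ex_is_arg_min_if_finite self_reachable[OF assms] by (metis empty_iff)
  then show ?thesis
    unfolding best_update_def by blast
qed

lemma serial_recursion_exists:
  assumes "M \<ge> 1" and "\<forall>i\<in>{1..M}. C0 i \<in> opinions M"
  shows "\<exists>C. C 0 = C0 \<and> serial_recursion M \<Delta> J C"
proof -
  let ?inv = "\<lambda>p C. (\<forall>i\<in>{1..M}. C i \<in> opinions M) \<and> (p = 0 \<longrightarrow> C = C0)"
  let ?step = "\<lambda>p C C'. \<exists>d. best_update M \<Delta> J (p mod M + 1) C d \<and> C' = C(p mod M + 1 := d)"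
  have "\<exists>C'. ?inv (Suc p) C' \<and> ?step p C C'" if inv: "?inv p C" for p C
  proof -
    have i: "p mod M + 1 \<in> {1..M}"
      using assms(1) by (simp add: Suc_leI)
    then obtain d where d: "best_update M \<Delta> J (p mod M + 1) C d"
      using best_update_exists inv by blast
    then have "d \<in> opinions M"
      using reachable_subset unfolding best_update_def is_arg_min_def by blast
    with inv d show ?thesis
      by (intro exI[of _ "C(p mod M + 1 := d)"]) auto
  qed
  from dependent_nat_choice[of ?inv ?step, OF _ this] assms(2)
  obtain C where "\<forall>p. ?inv p (C p)" "\<forall>p. ?step p (C p) (C (Suc p))"
    by blast
  then show ?thesis
    unfolding serial_recursion_def Let_def by blast
qed

end

theory Submission
  imports Defs
begin

text \<open>
  The game has the exact potential \<open>\<phi>\<close>: a unilateral change of opinion changes \<open>\<phi>\<close> and the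
  cost of the mover by the same amount.  There are finitely many profiles, so the run becomes constant
  at a profile in which no active subsystem can improve within its reachable set.

  Local minimality of a single opinion does not make it a global minimizer: a subsystem may be unable
  to join a neighbour without also joining the rest of that neighbour's coalition.  But splitting a
  neighbour \<open>j\<close> off the coalition of \<open>i\<close> is always one Hasse step, and it is profitable for \<open>i\<close>
  whenever \<open>j\<close> does not want to cooperate with \<open>i\<close>.  Hence at the limit profile all neighbours
  agree on whether they cooperate, and then each term of the cost of \<open>i\<close> is minimal.
\<close>

section \<open>Splitting a block of a partition\<close>

definition split_block :: "'a set \<Rightarrow> 'a set \<Rightarrow> 'a set set \<Rightarrow> 'a set set" where
  "split_block B U P = insert U (insert (B - U) (P - {B}))"

lemma partition_on_split_block:
  assumes P: "partition_on A P" and B: "B \<in> P" and U: "U \<subset> B" "U \<noteq> {}"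
  shows "partition_on A (split_block B U P)"
proof (rule partition_onI)
  have "\<Union>(split_block B U P) = \<Union>P"
    using B U(1) by (auto simp: split_block_def)
  then show "\<Union>(split_block B U P) = A"
    using partition_onD1[OF P] by simp
  show "{} \<notin> split_block B U P"
    using U partition_onD3[OF P] by (auto simp: split_block_def)
  have disj: "X \<inter> Y = {}" if "X \<in> P" "Y \<in> P" "X \<noteq> Y" for X Y
    using that partition_onD2[OF P] by (auto dest: disjointD)
  show "disjnt X Y" if "X \<in> split_block B U P" "Y \<in> split_block B U P" "X \<noteq> Y" for X Y
    using that U(1) disj[of X Y] disj[of B X] disj[of B Y] B
    unfolding split_block_def disjnt_def by blast
qed

lemma refines_split_block:
  assumes "partition_on A P" and "B \<in> P" and "U \<subset> B" "U \<noteq> {}"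
  shows "refines A (split_block B U P) P"
  using assms partition_on_split_block[OF assms] by (auto simp: refines_def split_block_def)

text \<open>A partition \<open>e\<close> in between that keeps \<open>B\<close> as a block is
  refined by \<open>P\<close>. If \<open>B\<close> is not a block of \<open>e\<close>, no block of
  \<open>e\<close> meets both pieces, so \<open>e\<close> refines the split partition. Antisymmetry
  finishes both cases.\<close>

lemma hasse_below_split_block:
  assumes P: "partition_on {1..M} P" and B: "B \<in> P" and U: "U \<subset> B" "U \<noteq> {}"
  shows "hasse_below M (split_block B U P) P"
  unfolding hasse_below_def
proof (intro conjI allI impI)
  let ?Q = "split_block B U P"
  show "refines {1..M} ?Q P"
    using assms by (rule refines_split_block)
  have "U \<notin> P"
    using partition_onD2[OF P] B U by (auto dest: disjointD)
  then show "?Q \<noteq> P"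
    by (auto simp: split_block_def)
  fix e
  assume "refines {1..M} ?Q e \<and> refines {1..M} e P"
  then have Qe: "refines {1..M} ?Q e" and eP: "refines {1..M} e P"
    by auto
  then have e: "partition_on {1..M} e" and Q: "partition_on {1..M} ?Q"
    by (auto simp: refines_def)
  show "e = ?Q \<or> e = P"
  proof (cases "B \<in> e")
    case True
    have "\<exists>Y\<in>e. X \<subseteq> Y" if "X \<in> P" for X
      using that True Qe by (cases "X = B") (auto simp: refines_def split_block_def)
    then have "refines {1..M} P e"
      using P e by (auto simp: refines_def)
    then show ?thesis
      using eP refines_asym by blast
  next
    case False
    have "\<exists>X\<in>?Q. Y \<subseteq> X" if Y: "Y \<in> e" for Y
    proof -
      obtain X where X: "X \<in> P" "Y \<subseteq> X"
        using eP Y by (auto simp: refines_def)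
      have same: "Z = Y" if "Z \<in> e" "Z \<inter> Y \<noteq> {}" for Z
        using that Y partition_onD2[OF e] by (auto dest: disjointD)
      obtain Z1 Z2 where Z: "Z1 \<in> e" "U \<subseteq> Z1" "Z2 \<in> e" "B - U \<subseteq> Z2"
        using Qe by (auto simp: refines_def split_block_def)
      show ?thesis
      proof (cases "X = B")
        case True
        have "Y \<noteq> B"
          using False Y by blast
        \<comment> \<open>Each piece lies in a single block of \<open>e\<close>, so a block
          \<open>Y\<close> meeting both pieces contains both and equals \<open>B\<close>.\<close>
        then have "Y \<inter> U = {} \<or> Y \<inter> (B - U) = {}"
          using X True Z same[of Z1] same[of Z2] by blast
        then have "Y \<subseteq> U \<or> Y \<subseteq> B - U"
          using X True by blast
        then show ?thesis
          by (auto simp: split_block_def)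
      qed (use X in \<open>auto simp: split_block_def\<close>)
    qed
    then have "refines {1..M} e ?Q"
      using e Q by (auto simp: refines_def)
    then show ?thesis
      using Qe refines_asym by blast
  qed
qed

text \<open>The two comparable partitions form a chain, and the list \<open>[c, ?d]\<close> of
  length two fits the bound \<open>\<Delta> + 1\<close> because
  \<open>\<Delta> \<ge> 1\<close>.\<close>

lemma reachable_split_block:
  assumes c: "c \<in> opinions M" and B: "B \<in> c" and U: "U \<subset> B" "U \<noteq> {}" and "\<Delta> \<ge> 1"
  shows "split_block B U c \<in> reachable M \<Delta> c"
proof -
  let ?d = "split_block B U c"
  have P: "partition_on {1..M} c"
    using c by (simp add: opinions_def)
  have d: "?d \<in> opinions M"
    using partition_on_split_block[OF P B U] by (simp add: opinions_def)
  have ref: "refines {1..M} ?d c"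
    by (rule refines_split_block[OF P B U])
  have "Complete_Partial_Order.chain (refines {1..M}) {c, ?d}"
    using ref c d by (auto simp: Complete_Partial_Order.chain_def opinions_def intro: refines_refl)
  moreover have "hasse_adjacent M c ?d"
    using hasse_below_split_block[OF P B U] by (simp add: hasse_adjacent_def)
  ultimately show ?thesis
    unfolding reachable_def using c d \<open>\<Delta> \<ge> 1\<close>
    by (intro CollectI exI[of _ "{c, ?d}"] exI[of _ "[c, ?d]"]) auto
qed

section \<open>Cooperation indicators\<close>

lemma delta_commute: "delta c i j = delta c j i"
  by (auto simp: delta_def)

lemma delta_cases: "delta c i j = 0 \<or> delta c i j = 1"
  by (simp add: delta_def)

text \<open>By disjointness \<open>B\<close> is the only block containing \<open>i\<close>. The
  coalition of \<open>i\<close> becomes \<open>B - {j}\<close>, so \<open>i\<close> is separated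
  from \<open>j\<close> and from nobody else.\<close>

lemma delta_split_member:
  assumes P: "partition_on A c" and B: "B \<in> c" "i \<in> B" "j \<in> B" and "i \<noteq> j"
  shows "delta (split_block B {j} c) i k = (if k = j then 1 else delta c i k)"
proof -
  have only: "X = B" if "X \<in> c" "X \<inter> B \<noteq> {}" for X
    using that B partition_onD2[OF P] by (auto dest: disjointD)
  show ?thesis
    using assms only by (auto simp: delta_def split_block_def)
qed

section \<open>The coalition game\<close>

text \<open>The linear system enters the game only through these properties. Symmetry of the
  neighbour relation is an assumption, since a nonzero block \<open>A_ij\<close> does not force
  \<open>A_ji\<close> to be nonzero.\<close>

locale coalition_game =
  fixes M :: nat and N :: "nat \<Rightarrow> nat set" and w \<sigma> :: "nat \<Rightarrow> nat \<Rightarrow> real" and \<rho> \<epsilon> :: real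
  assumes players: "M \<ge> 1"
    and neighbour: "j \<in> N i \<Longrightarrow> j \<in> {1..M} \<and> j \<noteq> i"
    and neighbour_sym: "i \<in> {1..M} \<Longrightarrow> j \<in> N i \<Longrightarrow> i \<in> N j"
    and weight_sym: "w i j = w j i"
    and weight_nonneg: "w i j \<ge> 0"
    and price_pos: "i \<in> {1..M} \<Longrightarrow> j \<in> {1..M} \<Longrightarrow> i \<noteq> j \<Longrightarrow> \<sigma> i j > 0"
    and rho_pos: "\<rho> > 0" and eps_pos: "\<epsilon> > 0"
begin

section \<open>Costs of links and the exact potential\<close>

abbreviation "J \<equiv> cost N w \<sigma> \<rho> \<epsilon>"
abbreviation "\<phi> \<equiv> potential M N w \<sigma> \<rho> \<epsilon>"

lemma finite_neighbours: "finite (N i)"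
  by (rule finite_subset[of _ "{1..M}"]) (use neighbour in auto)

text \<open>The indicators of \<open>i\<close> and of its neighbour \<open>j\<close> are free real
  arguments \<open>a\<close> and \<open>b\<close>, so that cooperating and separating can be
  compared on one link at a time.\<close>

definition link_cost :: "nat \<Rightarrow> nat \<Rightarrow> real \<Rightarrow> real \<Rightarrow> real" where
  "link_cost i j a b = w i j * \<bar>a - b\<bar> + \<rho> * ((w i j + \<epsilon>) * \<sigma> i j * (1 - a))"

lemma cost_eq_sum_link_cost:
  "J i c C = (\<Sum>j\<in>N i. link_cost i j (delta c i j) (delta (C j) i j))"
  by (simp add: cost_def consensus_cost_def power_cost_def link_cost_def sum.distrib sum_distrib_left)

lemma link_cost_nonneg:
  assumes "i \<in> {1..M}" "j \<in> N i"
  shows "link_cost i j (delta c i j) b \<ge> 0"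
  using assms neighbour[OF assms(2)] price_pos[of i j] rho_pos eps_pos weight_nonneg[of i j] delta_cases[of c i j]
  by (auto simp: link_cost_def)

lemma power_rate_pos:
  assumes "i \<in> {1..M}" "j \<in> N i"
  shows "\<rho> * ((w i j + \<epsilon>) * \<sigma> i j) > 0"
  using assms neighbour[OF assms(2)] price_pos[of i j] rho_pos eps_pos weight_nonneg[of i j]
  by (simp add: add_nonneg_pos)

text \<open>A disagreement between \<open>i\<close> and a neighbour is counted once for each of
  them, equally by symmetry and with factor 1/2, which restores the full consensus cost of
  \<open>i\<close>. The power cost depends on the player's own opinion only.\<close>

lemma exact_potential:
  assumes i: "i \<in> {1..M}"
  shows "\<phi> (C(i := d)) - \<phi> (C(i := e)) = J i d C - J i e C"
proof -
  \<comment> \<open>\<open>R\<close> collects the part of \<phi> that does not involve the opinion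
    of \<open>i\<close>.\<close>
  define R where "R = (\<Sum>k\<in>{1..M} - {i}. 1 / 2 * (\<Sum>j\<in>N k - {i}.
    w k j * \<bar>delta (C k) k j - delta (C j) k j\<bar>) + \<rho> * power_cost N w \<sigma> \<epsilon> k (C k))"
  have "\<phi> (C(i := d)) = J i d C + R" for d
  proof -
    let ?C = "C(i := d)"
    let ?f = "\<lambda>k. 1 / 2 * consensus_cost N w k (?C k) ?C + \<rho> * power_cost N w \<sigma> \<epsilon> k (?C k)"
    let ?g = "\<lambda>k. w i k * \<bar>delta d i k - delta (C k) i k\<bar>"
    let ?r = "\<lambda>k. 1 / 2 * (\<Sum>j\<in>N k - {i}. w k j * \<bar>delta (C k) k j - delta (C j) k j\<bar>)
      + \<rho> * power_cost N w \<sigma> \<epsilon> k (C k)"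
    have cons_i: "consensus_cost N w i d ?C = (\<Sum>k\<in>N i. ?g k)"
      and cons_i': "consensus_cost N w i d C = (\<Sum>k\<in>N i. ?g k)"
      unfolding consensus_cost_def using neighbour by (auto intro!: sum.cong)
    \<comment> \<open>Another player sees the opinion of \<open>i\<close> only in its summand for
      \<open>i\<close>; half of that summand is half of the summand for \<open>k\<close> in the cost
      of \<open>i\<close>.\<close>
    have other: "?f k = ?r k + (if k \<in> N i then 1 / 2 * ?g k else 0)" if k: "k \<in> {1..M} - {i}" for k
    proof -
      let ?h = "\<lambda>j. w k j * \<bar>delta (C k) k j - delta (?C j) k j\<bar>"
      have rest: "(\<Sum>j\<in>N k - {i}. ?h j) = (\<Sum>j\<in>N k - {i}. w k j * \<bar>delta (C k) k j - delta (C j) k j\<bar>)"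
        by (intro sum.cong) auto
      have iff: "i \<in> N k \<longleftrightarrow> k \<in> N i"
        using neighbour_sym i k by auto
      have "?h i = ?g k"
        using k by (simp add: weight_sym[of k i] delta_commute[of _ k i] abs_minus_commute)
      then have "(\<Sum>j\<in>N k. ?h j) = (\<Sum>j\<in>N k - {i}. ?h j) + (if k \<in> N i then ?g k else 0)"
        using iff sum.remove[OF finite_neighbours, of i k ?h] by (cases "i \<in> N k") simp_all
      then show ?thesis
        using k rest by (simp add: consensus_cost_def)
    qed
    have "({1..M} - {i}) \<inter> N i = N i"
      using neighbour by auto
    then have half: "(\<Sum>k\<in>{1..M} - {i}. if k \<in> N i then 1 / 2 * ?g k else 0) = (\<Sum>k\<in>N i. 1 / 2 * ?g k)"
      by (simp add: sum.inter_restrict[symmetric])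
    have "\<phi> ?C = ?f i + (\<Sum>k\<in>{1..M} - {i}. ?f k)"
      unfolding potential_def using i by (intro sum.remove) auto
    also have "(\<Sum>k\<in>{1..M} - {i}. ?f k) = R + (\<Sum>k\<in>N i. 1 / 2 * ?g k)"
      unfolding R_def half[symmetric] sum.distrib[symmetric] using other by (rule sum.cong[OF refl])
    also have "?f i + (R + (\<Sum>k\<in>N i. 1 / 2 * ?g k)) = J i d C + R"
      unfolding cost_def fun_upd_same cons_i cons_i' sum_distrib_left[symmetric] by simp
    finally show ?thesis .
  qed
  then show ?thesis
    by simp
qed

text \<open>An exact potential ranks unilateral deviations of a player just as the cost of that
  player does.\<close>

lemma nash_iff_potential_minimum: "nash_equilibrium M J E \<longleftrightarrow> potential_minimum M \<phi> E"
proof -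
  have "\<phi> (E(i := d)) < \<phi> (E(i := E i)) \<longleftrightarrow> J i d E < J i (E i) E" if "i \<in> {1..M}" for i d
    using exact_potential[OF that, of E d "E i"] by linarith
  then show ?thesis
    unfolding nash_equilibrium_def potential_minimum_def is_arg_min_def by auto
qed

section \<open>From local stability to Nash equilibrium\<close>

definition locally_stable :: "nat \<Rightarrow> nat \<Rightarrow> profile \<Rightarrow> bool" where
  "locally_stable \<Delta> i E \<longleftrightarrow> is_arg_min (\<lambda>d. J i d E) (\<lambda>d. d \<in> reachable M \<Delta> (E i)) (E i)"

text \<open>Splitting \<open>j\<close> off the coalition is a reachable move that changes only the
  link to \<open>j\<close>; all other terms cancel.\<close>

lemma locally_stable_link:
  assumes st: "locally_stable \<Delta> i E" and "\<Delta> \<ge> 1" and E: "E i \<in> opinions M" and i: "i \<in> {1..M}"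
    and j: "j \<in> N i" and same: "delta (E i) i j = 0"
  shows "link_cost i j 0 (delta (E j) i j) \<le> link_cost i j 1 (delta (E j) i j)"
proof -
  have P: "partition_on {1..M} (E i)"
    using E by (simp add: opinions_def)
  obtain B where B: "B \<in> E i" "i \<in> B" "j \<in> B"
    using same by (auto simp: delta_def split: if_splits)
  have ij: "i \<noteq> j"
    using neighbour[OF j] by auto
  let ?d = "split_block B {j} (E i)"
  let ?l = "\<lambda>c k. link_cost i k (delta c i k) (delta (E k) i k)"
  have "?d \<in> reachable M \<Delta> (E i)"
    by (rule reachable_split_block) (use E B ij \<open>\<Delta> \<ge> 1\<close> in auto)
  then have "J i (E i) E \<le> J i ?d E"
    using st by (auto simp: locally_stable_def is_arg_min_linorder)
  moreover have "(\<Sum>k\<in>N i - {j}. ?l ?d k) = (\<Sum>k\<in>N i - {j}. ?l (E i) k)"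
    by (intro sum.cong) (auto simp: delta_split_member[OF P B ij])
  ultimately have "?l (E i) j \<le> ?l ?d j"
    by (simp add: cost_eq_sum_link_cost sum.remove[OF finite_neighbours j])
  then show ?thesis
    by (simp add: same delta_split_member[OF P B ij])
qed

text \<open>If \<open>j\<close> did not cooperate, keeping the link would cost \<open>i\<close> at
  least the positive power rate, while splitting \<open>j\<close> off would make it free.\<close>

lemma locally_stable_agree:
  assumes "locally_stable \<Delta> i E" "\<Delta> \<ge> 1" "E i \<in> opinions M" "i \<in> {1..M}" "j \<in> N i"
    and "delta (E i) i j = 0"
  shows "delta (E j) i j = 0"
  using locally_stable_link[OF assms] power_rate_pos[OF assms(4,5)] weight_nonneg[of i j]
    delta_cases[of "E j" i j]
  by (auto simp: link_cost_def)

lemma locally_stable_imp_nash: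
  assumes st: "\<And>i. i \<in> {1..M} \<Longrightarrow> locally_stable \<Delta> i E" and "\<Delta> \<ge> 1"
    and E: "\<And>i. i \<in> {1..M} \<Longrightarrow> E i \<in> opinions M"
  shows "nash_equilibrium M J E"
proof -
  have "J i (E i) E \<le> J i d E" if i: "i \<in> {1..M}" for i d
    unfolding cost_eq_sum_link_cost
  \<comment> \<open>The comparison is made link by link, so it does not matter which combinations of
    indicators a partition can realise.\<close>
  proof (rule sum_mono)
    fix j assume j: "j \<in> N i"
    have jM: "j \<in> {1..M}" and ij: "i \<in> N j"
      using neighbour[OF j] neighbour_sym[OF i j] by auto
    show "link_cost i j (delta (E i) i j) (delta (E j) i j)
      \<le> link_cost i j (delta d i j) (delta (E j) i j)"
    proof (cases "delta (E i) i j = 0")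
      case True
      then show ?thesis
        using locally_stable_link[OF st[OF i] \<open>\<Delta> \<ge> 1\<close> E[OF i] i j] delta_cases[of d i j] by auto
    next
      case False
      \<comment> \<open>Agreement is applied with the roles exchanged: if \<open>j\<close>
        cooperated with \<open>i\<close>, then \<open>i\<close> would cooperate with
        \<open>j\<close>.\<close>
      then have "delta (E j) i j \<noteq> 0"
        using locally_stable_agree[OF st[OF jM] \<open>\<Delta> \<ge> 1\<close> E[OF jM] jM ij] delta_commute by metis
      then have "link_cost i j (delta (E i) i j) (delta (E j) i j) = 0"
        using False delta_cases[of "E i" i j] delta_cases[of "E j" i j] by (simp add: link_cost_def)
      then show ?thesis
        using link_cost_nonneg[OF i j] by simp
    qed
  qed
  then show ?thesis
    using E by (auto simp: nash_equilibrium_def is_arg_min_linorder)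
qed

section \<open>The run of the serial recursion\<close>

lemma active_player: "p mod M + 1 \<in> {1..M}"
  using players by (simp add: Suc_leI)

lemma recursion_step:
  assumes "serial_recursion M \<Delta> J C"
  obtains d where "best_update M \<Delta> J (p mod M + 1) (C p) d" "C (Suc p) = (C p)(p mod M + 1 := d)"
  using assms unfolding serial_recursion_def Let_def by blast

lemma recursion_opinions:
  assumes rec: "serial_recursion M \<Delta> J C" and init: "\<And>i. i \<in> {1..M} \<Longrightarrow> C 0 i \<in> opinions M"
  shows "i \<in> {1..M} \<Longrightarrow> C p i \<in> opinions M"
proof (induction p)
  case (Suc p)
  obtain d where d: "best_update M \<Delta> J (p mod M + 1) (C p) d" "C (Suc p) = (C p)(p mod M + 1 := d)"
    using rec by (rule recursion_step)
  then have "d \<in> opinions M"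
    using reachable_subset unfolding best_update_def is_arg_min_def by blast
  then show ?case
    using Suc d by simp
qed (rule init)

text \<open>Profiles are functions on all naturals; freezing the entries of non-players is what
  leaves only finitely many profiles for the run.\<close>

lemma recursion_outside:
  assumes "serial_recursion M \<Delta> J C"
  shows "i \<notin> {1..M} \<Longrightarrow> C p i = C 0 i"
proof (induction p)
  case (Suc p)
  obtain d where "C (Suc p) = (C p)(p mod M + 1 := d)"
    using assms by (rule recursion_step)
  then show ?case
    using Suc active_player[of p] by auto
qed simp

text \<open>The tie-breaking clause of \<open>best_update\<close> ensures that an actual move
  happens only when the current opinion is not a minimizer, so the mover's cost drops strictly, and
  \<phi> drops with it.\<close>

lemma recursion_improves:
  assumes rec: "serial_recursion M \<Delta> J C" and init: "\<And>i. i \<in> {1..M} \<Longrightarrow> C 0 i \<in> opinions M"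
  shows "improvement_path \<phi> C"
  unfolding improvement_path_def
proof (intro allI impI)
  fix p assume moved: "C (Suc p) \<noteq> C p"
  let ?i = "p mod M + 1"
  obtain d where d: "best_update M \<Delta> J ?i (C p) d" "C (Suc p) = (C p)(?i := d)"
    using rec by (rule recursion_step)
  have "d \<noteq> C p ?i"
    using moved d(2) by auto
  moreover have "C p ?i \<in> reachable M \<Delta> (C p ?i)"
    by (intro self_reachable recursion_opinions[OF rec init] active_player)
  ultimately have "J ?i d (C p) < J ?i (C p ?i) (C p)"
    using d(1) unfolding best_update_def is_arg_min_linorder by fastforce
  then show "\<phi> (C (Suc p)) < \<phi> (C p)"
    using exact_potential[OF active_player[of p], of "C p" d "C p ?i"] d(2) by simp
qed

lemma recursion_range_finite:
  assumes rec: "serial_recursion M \<Delta> J C" and init: "\<And>i. i \<in> {1..M} \<Longrightarrow> C 0 i \<in> opinions M"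
  shows "finite (range C)"
proof (rule finite_subset)
  let ?F = "(\<lambda>g i. if i \<in> {1..M} then g i else C 0 i) ` Pi\<^sub>E {1..M} (\<lambda>_. opinions M)"
  show "finite ?F"
    using finitely_many_partition_on[of "{1..M}"]
    by (intro finite_imageI finite_PiE) (auto simp: opinions_def)
  show "range C \<subseteq> ?F"
  proof (rule image_subsetI)
    fix p
    have "C p = (\<lambda>i. if i \<in> {1..M} then restrict (C p) {1..M} i else C 0 i)"
      using recursion_outside[OF rec, of _ p] by (intro ext) (simp only: restrict_apply split: if_split, blast)
    moreover have "restrict (C p) {1..M} \<in> Pi\<^sub>E {1..M} (\<lambda>_. opinions M)"
      using recursion_opinions[OF rec init] by simp
    ultimately show "C p \<in> ?F"
      by (rule image_eqI)
  qed
qed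

text \<open>Every player is active again after the run has become constant, and its update then
  returns the opinion it already holds.\<close>

lemma recursion_limit_stable:
  assumes rec: "serial_recursion M \<Delta> J C" and limit: "\<And>p. p \<ge> P \<Longrightarrow> C p = E" and i: "i \<in> {1..M}"
  shows "locally_stable \<Delta> i E"
proof -
  obtain k where k: "i = Suc k" "k < M"
    using i by (cases i) auto
  \<comment> \<open>A time at which \<open>i = Suc k\<close> is active, late enough because
    \<open>M \<ge> 1\<close>.\<close>
  define p where "p = k + P * M"
  have p: "p mod M + 1 = i" "p \<ge> P"
    using k players by (auto simp: p_def intro: trans_le_add2)
  obtain d where d: "best_update M \<Delta> J (p mod M + 1) (C p) d" "C (Suc p) = (C p)(p mod M + 1 := d)"
    using rec by (rule recursion_step)
  have "d = E i"
    using d(2) p limit[of p] limit[of "Suc p"] by (metis fun_upd_same le_SucI)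
  then have "best_update M \<Delta> J i E (E i)"
    using d(1) unfolding p(1) limit[OF p(2)] by simp
  then show ?thesis
    by (simp add: best_update_def locally_stable_def)
qed

end

section \<open>Termination and the equilibrium\<close>

lemma improvement_path_terminates:
  assumes imp: "improvement_path \<phi> C" and fin: "finite (range C)"
  obtains P where "\<And>p. p \<ge> P \<Longrightarrow> C p = C P"
proof -
  \<comment> \<open>Finiteness of the range gives a time \<open>P\<close> of least potential; any
    later move would fall below that minimum.\<close>
  obtain P where min: "\<And>p. \<phi> (C P) \<le> \<phi> (C p)"
    using ex_is_arg_min_if_finite[OF fin, of \<phi>] by (auto simp: is_arg_min_linorder)
  have "C p = C P" if "p \<ge> P" for p
    using that
  proof (induction p rule: dec_induct)
    case (step p)
    have "\<not> \<phi> (C (Suc p)) < \<phi> (C p)"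
      using min[of "Suc p"] step.IH by simp
    then show ?case
      using imp step.IH unfolding improvement_path_def by metis
  qed simp
  then show thesis ..
qed

lemma weight_commute: "weight s A x i j = weight s A x j i"
  by (simp add: weight_def add.commute)

lemma weight_nonneg: "weight s A x i j \<ge> 0"
  by (simp add: weight_def onorm_pos_le matrix_vector_mul_bounded_linear)

theorem theorem4p2:
  fixes A :: "real^'n^'n" and s :: "'n \<Rightarrow> nat" and x :: "real^'n"
    and M \<Delta> :: nat and \<sigma> :: "nat \<Rightarrow> nat \<Rightarrow> real" and \<rho> \<epsilon> :: real
    and N :: "nat \<Rightarrow> nat set" and w :: "nat \<Rightarrow> nat \<Rightarrow> real"
    and J :: "nat \<Rightarrow> opinion \<Rightarrow> profile \<Rightarrow> real" and \<phi> :: "profile \<Rightarrow> real"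
    and C :: "nat \<Rightarrow> profile"
  assumes subsystems: "range s = {1..M}"
    and N: "N = neighbours M s A"
    and w: "w = weight s A x"
    and J: "J = cost N w \<sigma> \<rho> \<epsilon>"
    and \<phi>: "\<phi> = potential M N w \<sigma> \<rho> \<epsilon>"
    and symmetric: "\<And>i j. i \<in> {1..M} \<Longrightarrow> j \<in> N i \<Longrightarrow> i \<in> N j"
    and \<sigma>: "\<And>i j. i \<in> {1..M} \<Longrightarrow> j \<in> {1..M} \<Longrightarrow> i \<noteq> j \<Longrightarrow> \<sigma> i j = \<sigma> j i \<and> \<sigma> i j > 0"
    and "\<rho> > 0" and "\<epsilon> > 0" and "\<Delta> \<ge> 1"
    and initial: "\<And>i. i \<in> {1..M} \<Longrightarrow> C 0 i \<in> opinions M"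
    and recursion: "serial_recursion M \<Delta> J C"
  shows "improvement_path \<phi> C
    \<and> (\<exists>E. terminates_in C E \<and> nash_equilibrium M J E \<and> potential_minimum M \<phi> E)"
proof -
  \<comment> \<open>The range of \<open>s\<close> is nonempty, so there is at least one
    player.\<close>
  have "M \<ge> 1"
    using subsystems by (cases M) auto
  interpret coalition_game M N w \<sigma> \<rho> \<epsilon>
    by unfold_locales
      (use \<open>M \<ge> 1\<close> symmetric \<sigma> \<open>\<rho> > 0\<close> \<open>\<epsilon> > 0\<close> in
        \<open>auto simp: N neighbours_def w weight_nonneg intro: weight_commute\<close>)
  note rec = recursion[unfolded J]
  have imp: "improvement_path \<phi> C"
    unfolding \<phi> by (rule recursion_improves[OF rec initial])
  obtain P where P: "\<And>p. p \<ge> P \<Longrightarrow> C p = C P"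
    using improvement_path_terminates[OF imp recursion_range_finite[OF rec initial]] by blast
  have nash: "nash_equilibrium M J (C P)"
    unfolding J using recursion_limit_stable[OF rec P] \<open>\<Delta> \<ge> 1\<close> recursion_opinions[OF rec initial]
    by (rule locally_stable_imp_nash)
  moreover have "potential_minimum M \<phi> (C P)"
    using nash by (simp add: J \<phi> nash_iff_potential_minimum)
  moreover have "terminates_in C (C P)"
    unfolding terminates_in_def using P by blast
  ultimately show ?thesis
    using imp by blast
qed

end
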